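(* Let $(X,\hookrightarrow,\mathcal{P})$ be a primal-proximity space such that $\mathcal{P}=2^X\setminus\{X\}$. Then the operator $2^X\to 2^X$, $A\mapsto \overset{\hookrightarrow}{A}:=\{x\in X : \{x\}\hookrightarrow A\}$, is a Kuratowski closure operator.
   Context: $A^c$ denotes $X\setminus A$. A primal on a non-empty set $X$ is a collection $\mathcal{P}\subseteq 2^X$ such that (i) $X\notin\mathcal{P}$; (ii) if $A\in\mathcal{P}$ and $B\subseteq A$, then $B\in\mathcal{P}$; (iii) if $A\cap B\in\mathcal{P}$, then $A\in\mathcal{P}$ or $B\in\mathcal{P}$. A primal-proximity space $(X,\hookrightarrow,\mathcal{P})$ is a non-empty set $X$ with a primal $\mathcal{P}$ on $X$ and a binary relation $\hookrightarrow$ on $2^X$ such that for all $A,B,C\subseteq X$: (1) if $A\hookrightarrow B$, then $B\hookrightarrow A$; (2) $A\hookrightarrow (B\cup C)$ iff $A\hookrightarrow B$ or $A\hookrightarrow C$; (3) if $A^c\notin\mathcal{P}$, then $A\not\hookrightarrow B$ for all $B\subseteq X$; (4) if $(A\cap B)^c\in\mathcal{P}$, then $A\hookrightarrow B$; (5) if $A\not\hookrightarrow B$, then there exist $C,D\subseteq X$ such that $A\not\hookrightarrow C^c$, $D^c\not\hookrightarrow B$ and $(C\cap D)^c\notin\mathcal{P}$. An operator $\Phi:2^X\to 2^X$ is a Kuratowski closure operator if (1) $\Phi(\emptyset)=\emptyset$; (2) $A\subseteq\Phi(A)$ for all $A\subseteq X$; (3) $\Phi(A\cup B)=\Phi(A)\cup\Phi(B)$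 for all $A,B\subseteq X$; (4) $\Phi(\Phi(A))=\Phi(A)$ for all $A\subseteq X$. *)

theory Defs
  imports Main
begin

text \<open>
  The underlying set is an explicit carrier \<open>X\<close>; complements are relative to it,
  and every quantifier over subsets is restricted to subsets of \<open>X\<close>. A relation on the
  power set of \<open>X\<close> is a binary predicate on sets, and an operator on it is a function on
  sets; the values of either outside \<open>Pow X\<close> are irrelevant.
\<close>

definition primal :: "'a set \<Rightarrow> 'a set set \<Rightarrow> bool" where
  "primal X P \<longleftrightarrow>
     X \<noteq> {} \<and>
     P \<subseteq> Pow X \<and>
     X \<notin> P \<and>
     (\<forall>A B. A \<in> P \<and> B \<subseteq> A \<longrightarrow> B \<in> P) \<and>
     (\<forall>A B. A \<subseteq> X \<and> B \<subseteq> X \<and> A \<inter> B \<in> P \<longrightarrow> A \<in> P \<or> B \<in> P)"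

locale primal_proximity_space =
  fixes X :: "'a set"
    and near :: "'a set \<Rightarrow> 'a set \<Rightarrow> bool"  (infix \<open>\<hookrightarrow>\<close> 50)
    and P :: "'a set set"
  assumes primal: "primal X P"
    and near_sym:
      "\<lbrakk>A \<subseteq> X; B \<subseteq> X; A \<hookrightarrow> B\<rbrakk> \<Longrightarrow> B \<hookrightarrow> A"
    and near_Un_iff:
      "\<lbrakk>A \<subseteq> X; B \<subseteq> X; C \<subseteq> X\<rbrakk> \<Longrightarrow> A \<hookrightarrow> (B \<union> C) \<longleftrightarrow> A \<hookrightarrow> B \<or> A \<hookrightarrow> C"
    and not_near_if_compl_notin:
      "\<lbrakk>A \<subseteq> X; X - A \<notin> P; B \<subseteq> X\<rbrakk> \<Longrightarrow> \<not> A \<hookrightarrow> B"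
    and near_if_compl_Int_in:
      "\<lbrakk>A \<subseteq> X; B \<subseteq> X; X - (A \<inter> B) \<in> P\<rbrakk> \<Longrightarrow> A \<hookrightarrow> B"
    and not_near_separated:
      "\<lbrakk>A \<subseteq> X; B \<subseteq> X; \<not> A \<hookrightarrow> B\<rbrakk> \<Longrightarrow>
         \<exists>C D. C \<subseteq> X \<and> D \<subseteq> X \<and> \<not> A \<hookrightarrow> (X - C) \<and> \<not> (X - D) \<hookrightarrow> B \<and> X - (C \<inter> D) \<notin> P"

definition proximity_operator ::
    "'a set \<Rightarrow> ('a set \<Rightarrow> 'a set \<Rightarrow> bool) \<Rightarrow> 'a set \<Rightarrow> 'a set" where
  "proximity_operator X near A = {x \<in> X. near {x} A}"

definition kuratowski_closure_operator :: "'a set \<Rightarrow> ('a set \<Rightarrow> 'a set) \<Rightarrow> bool" where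
  "kuratowski_closure_operator X \<Phi> \<longleftrightarrow>
     (\<forall>A. A \<subseteq> X \<longrightarrow> \<Phi> A \<subseteq> X) \<and>
     \<Phi> {} = {} \<and>
     (\<forall>A. A \<subseteq> X \<longrightarrow> A \<subseteq> \<Phi> A) \<and>
     (\<forall>A B. A \<subseteq> X \<and> B \<subseteq> X \<longrightarrow> \<Phi> (A \<union> B) = \<Phi> A \<union> \<Phi> B) \<and>
     (\<forall>A. A \<subseteq> X \<longrightarrow> \<Phi> (\<Phi> A) = \<Phi> A)"

end

theory Submission
  imports Defs
begin

text \<open>
  Idempotence is the only point where separation is used. For this primal, separation of
  \<open>{x}\<close> from \<open>A\<close> yields disjoint sets \<open>C\<close> and \<open>D\<close> with \<open>{x}\<close> far from \<open>X - C\<close> and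
  \<open>X - D \<supseteq> C\<close> far from \<open>A\<close>. No point of \<open>C\<close> is then near \<open>A\<close>, so the closure of \<open>A\<close> lies in
  \<open>X - C\<close> and \<open>{x}\<close> is far from it.
\<close>

context primal_proximity_space
begin

lemma near_mono_right:
  assumes "A \<subseteq> X" "C \<subseteq> X" "B \<subseteq> C" "A \<hookrightarrow> B"
  shows "A \<hookrightarrow> C"
proof -
  have "B \<subseteq> X" "B \<union> C = C" using assms by auto
  then show ?thesis using near_Un_iff[of A B C] assms by auto
qed

lemma near_mono_left:
  assumes "C \<subseteq> X" "B \<subseteq> X" "A \<subseteq> C" "A \<hookrightarrow> B"
  shows "C \<hookrightarrow> B"
proof -
  have "A \<subseteq> X" using assms by blast
  then have "B \<hookrightarrow> C"
    using assms near_sym[of A B] near_mono_right[of B C A] by blast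
  then show ?thesis using assms near_sym by blast
qed

text \<open>The complement of \<open>{}\<close> is \<open>X\<close>, which no primal contains, so
  \<open>{}\<close> is far from every subset; symmetry moves it to the right.\<close>

lemma not_near_empty:
  assumes "A \<subseteq> X"
  shows "\<not> A \<hookrightarrow> {}"
proof -
  have "X \<notin> P" using primal by (simp add: primal_def)
  then show ?thesis
    using not_near_if_compl_notin[of "{}" A] near_sym[of A "{}"] assms by auto
qed

text \<open>The separation argument works for any \<open>B\<close>, not just a point; its
  contrapositive at \<open>{x}\<close> gives idempotence.\<close>

lemma not_near_proximity_operator:
  assumes P: "P = Pow X - {X}" and A: "A \<subseteq> X" and B: "B \<subseteq> X" and far: "\<not> B \<hookrightarrow> A"
  shows "\<not> B \<hookrightarrow> proximity_operator X near A"
proof -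
  obtain C D where CD: "C \<subseteq> X" "D \<subseteq> X" "\<not> B \<hookrightarrow> (X - C)" "\<not> (X - D) \<hookrightarrow> A" "X - (C \<inter> D) \<notin> P"
    using not_near_separated[OF B A far] by blast
  \<comment> \<open>The only subset of \<open>X\<close> outside \<open>P\<close> is \<open>X\<close>
    itself, so \<open>X - (C \<inter> D) = X\<close>.\<close>
  have "C \<inter> D = {}" using CD P by auto
  have "proximity_operator X near A \<subseteq> X - C"
  proof
    fix y assume "y \<in> proximity_operator X near A"
    then have y: "y \<in> X" "{y} \<hookrightarrow> A" by (simp_all add: proximity_operator_def)
    \<comment> \<open>Otherwise \<open>{y} \<subseteq> X - D\<close>, and monotonicity would make
      \<open>X - D\<close> near \<open>A\<close>.\<close>
    then have "y \<in> D"
      using CD(4) A near_mono_left[of "X - D" A "{y}"] by blast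
    then show "y \<in> X - C" using y \<open>C \<inter> D = {}\<close> by blast
  qed
  then show ?thesis
    using near_mono_right[OF B, of "X - C"] CD(3) by blast
qed

end

theorem theorem5p6:
  fixes X :: "'a set"
    and near :: "'a set \<Rightarrow> 'a set \<Rightarrow> bool"
    and P :: "'a set set"
  assumes "primal_proximity_space X near P"
    and "P = Pow X - {X}"
  shows "kuratowski_closure_operator X (proximity_operator X near)"
proof -
  interpret primal_proximity_space X near P by fact
  let ?cl = "proximity_operator X near"
  have carrier: "?cl A \<subseteq> X" for A
    by (auto simp: proximity_operator_def)
  have empty: "?cl {} = {}"
    using not_near_empty by (auto simp: proximity_operator_def)
  have extensive: "A \<subseteq> ?cl A" if A: "A \<subseteq> X" for A
  proof
    fix x assume "x \<in> A"
    \<comment> \<open>The complement of \<open>{x} \<inter> A = {x}\<close> misses \<open>x\<close>,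
      so it differs from \<open>X\<close> and lies in \<open>P\<close>.\<close>
    then have "near {x} A"
      using A assms(2) by (intro near_if_compl_Int_in) auto
    then show "x \<in> ?cl A"
      using \<open>x \<in> A\<close> A by (auto simp: proximity_operator_def)
  qed
  have union: "?cl (A \<union> B) = ?cl A \<union> ?cl B" if "A \<subseteq> X" "B \<subseteq> X" for A B
    using that near_Un_iff[of "{_}" A B] by (auto simp: proximity_operator_def)
  have idem: "?cl (?cl A) = ?cl A" if A: "A \<subseteq> X" for A
  proof
    show "?cl (?cl A) \<subseteq> ?cl A"
    proof
      fix x assume "x \<in> ?cl (?cl A)"
      then have "x \<in> X" "near {x} (?cl A)"
        \<comment> \<open>Only the outer closure is unfolded; the inner one must stay intact for the
          far-set lemma.\<close>
        unfolding proximity_operator_def[of X near "?cl A"] by simp_all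
      moreover from this have "near {x} A"
        using not_near_proximity_operator[OF assms(2) A, of "{x}"] by blast
      ultimately show "x \<in> ?cl A"
        unfolding proximity_operator_def by simp
    qed
    show "?cl A \<subseteq> ?cl (?cl A)"
      by (rule extensive[OF carrier])
  qed
  show ?thesis
    unfolding kuratowski_closure_operator_def
    using carrier empty extensive union idem by blast
qed

end
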